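(* Let $R$ be a finite commutative ring with unity, let $U(R)$ be its set of units, and let $\Gamma'^{c}(R)$ be the complement unity product graph associated with $R$. Then $\Gamma'^{c}(R)$ is planar if and only if $|U(R)|\leq 4$.
   Context: For a ring $R$ with unity $e$ and set of units $U(R)$, the complement unity product graph $\Gamma'^{c}(R)$ is the simple graph with vertex set $U(R)$ in which two distinct vertices $r_i,r_j$ are adjacent if and only if $r_i\cdot r_j\neq e$. A graph is planar if it can be drawn in the plane such that no two of its edges cross; equivalently (Kuratowski's theorem), if it does not contain a subdivision of $K_5$ or $K_{3,3}$ as a subgraph. *)

theory Defs
  imports "HOL-Analysis.Analysis" "HOL-Algebra.Ring" "Graph_Theory.Pair_Digraph"
begin

text \<open>
  As in the theory of digraphs imported here, a simple graph is a symmetric loop-free set of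
  ordered pairs, so an undirected edge joining \<open>u\<close> and \<open>v\<close> is represented by both \<open>(u, v)\<close> and
  \<open>(v, u)\<close>.
\<close>

definition complement_unity_product_graph :: "('a, 'm) ring_scheme \<Rightarrow> 'a pair_pre_digraph" where
  "complement_unity_product_graph R =
     \<lparr> pverts = Units R,
       parcs = {(r, s). r \<in> Units R \<and> s \<in> Units R \<and> r \<noteq> s \<and> r \<otimes>\<^bsub>R\<^esub> s \<noteq> \<one>\<^bsub>R\<^esub>} \<rparr>"

lemma (in ring) pair_graph_complement_unity_product_graph:
  assumes "finite (carrier R)"
  shows "pair_graph (complement_unity_product_graph R)"
proof -
  have fin: "finite (Units R)"
    using assms by (rule rev_finite_subset) auto
  then have "finite (parcs (complement_unity_product_graph R))"
    by (rule_tac finite_subset[of _ "Units R \<times> Units R"])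
       (auto simp: complement_unity_product_graph_def)
  moreover have "s \<otimes> r = \<one> \<Longrightarrow> r \<otimes> s = \<one>" if "r \<in> Units R" "s \<in> Units R" for r s
    using that by (meson Units_closed Units_inv_comm)
  ultimately show ?thesis
    using fin
    by unfold_locales (auto simp: complement_unity_product_graph_def symmetric_def intro!: symI)
qed

text \<open>
  A drawing in the plane (taken to be the type of complex numbers) places the vertices at distinct
  points \<open>p v\<close> and draws each undirected edge \<open>{u, v}\<close> as one arc (an injective continuous curve)
  \<open>c {u, v}\<close> that joins the points of its two end vertices, in either direction, and passes through
  no other vertex. Distinct edges do not cross: they may meet only in points that carry a vertex,
  which are then common end vertices.
\<close>

definition planar_drawing ::
    "'a pair_pre_digraph \<Rightarrow> ('a \<Rightarrow> complex) \<Rightarrow> ('a set \<Rightarrow> real \<Rightarrow> complex) \<Rightarrow> bool" where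
  "planar_drawing G p c \<longleftrightarrow>
     inj_on p (pverts G) \<and>
     (\<forall>(u, v) \<in> parcs G.
        arc (c {u, v}) \<and>
        {pathstart (c {u, v}), pathfinish (c {u, v})} = {p u, p v} \<and>
        path_image (c {u, v}) \<inter> p ` pverts G = {p u, p v}) \<and>
     (\<forall>(u, v) \<in> parcs G. \<forall>(x, y) \<in> parcs G. {u, v} \<noteq> {x, y} \<longrightarrow>
        path_image (c {u, v}) \<inter> path_image (c {x, y}) \<subseteq> p ` pverts G)"

definition planar :: "'a pair_pre_digraph \<Rightarrow> bool" where
  "planar G \<longleftrightarrow> (\<exists>p c. planar_drawing G p c)"

end

theory Submission
  imports Defs
begin

text \<open>
  Up to four units, the graph is a subgraph of the complete graph \<open>K\<^sub>4\<close>, which has a straight-line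
  drawing as a triangle with its centroid.

  From six units on, the graph contains \<open>K\<^sub>3\<^sub>,\<^sub>3\<close>: each unit fails to be adjacent to at most one other
  vertex, namely its inverse. Hence a set of three units that is closed under inverses, such as
  \<open>{1, x, x\<^sup>-\<^sup>1}\<close> (lemma \<open>inverse_closed_triple\<close>), is completely joined to its complement.

  Exactly five units cannot occur (lemma \<open>card_Units_neq_5\<close>). The fifth power of \<open>-1\<close> would be \<open>1\<close>,
  so the ring would have characteristic two. For a unit \<open>x \<noteq> 1\<close> the element \<open>1 + x + x\<^sup>-\<^sup>1\<close> would
  have third power \<open>1\<close> as well as fifth power \<open>1\<close> and hence be \<open>1\<close>; then \<open>x = x\<^sup>-\<^sup>1\<close>, which is
  impossible for an element of order five. This case matters because \<open>K\<^sub>5\<close> without two disjoint edges,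
  which a group of five units would give, is planar.

  That \<open>K\<^sub>3\<^sub>,\<^sub>3\<close> has no drawing by arbitrary arcs is derived from the Jordan curve theorem. Two vertices
  \<open>u\<^sub>1, u\<^sub>2\<close> of one side and the three vertices of the other side span a theta curve: three arcs from
  \<open>u\<^sub>1\<close> to \<open>u\<^sub>2\<close>, one through each vertex of the other side. The third vertex \<open>w\<close> lies in a face of this
  curve, and its three edges stay in that face until they reach their ends, so the closure of the
  face meets the interior of each of the three arcs. But every face of a theta curve is bounded by
  only two of the arcs (theorem \<open>face_closure_misses_arc\<close>).
\<close>

section \<open>Theta curves\<close>

lemma component_closure_subset_inside:
  fixes S :: "complex set"
  assumes "closed S" "connected K" "K \<inter> S = {}" "z \<in> K" "z \<in> inside S"
  shows "closure K \<subseteq> S \<union> inside S"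
proof -
  have "K \<subseteq> inside S"
    by (metis assms(2-5) connected_component_def disjoint_eq_subset_Compl inside_same_component subsetI)
  then show ?thesis
    using closure_inside_subset[OF assms(1)] closure_mono by blast
qed

lemma component_closure_subset_outside:
  fixes S :: "complex set"
  assumes "closed S" "connected K" "K \<inter> S = {}" "z \<in> K" "z \<in> outside S"
  shows "closure K \<subseteq> S \<union> outside S"
proof -
  have "K \<subseteq> outside S"
    by (metis assms(2-5) connected_component_def disjoint_eq_subset_Compl outside_same_component subsetI)
  then show ?thesis
    using closure_outside_subset[OF assms(1)] closure_mono by blast
qed

locale theta_curve =
  fixes c1 c2 c3 :: "real \<Rightarrow> complex" and a b :: complex
  assumes arcs: "arc c1" "arc c2" "arc c3"
    and starts: "pathstart c1 = a" "pathstart c2 = a" "pathstart c3 = a"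
    and finishes: "pathfinish c1 = b" "pathfinish c2 = b" "pathfinish c3 = b"
    and meets: "path_image c1 \<inter> path_image c2 = {a, b}"
      "path_image c1 \<inter> path_image c3 = {a, b}"
      "path_image c2 \<inter> path_image c3 = {a, b}"
begin

abbreviation "C1 \<equiv> path_image c1"
abbreviation "C2 \<equiv> path_image c2"
abbreviation "C3 \<equiv> path_image c3"

text \<open>
  The hypotheses are symmetric in the three arcs, so every result holds for all their permutations;
  these two generate them.
\<close>

lemma rotate: "theta_curve c2 c3 c1 a b"
  by unfold_locales (use arcs starts finishes meets in auto)

lemma swap: "theta_curve c1 c3 c2 a b"
  by unfold_locales (use arcs starts finishes meets in auto)

lemma ends_distinct: "a \<noteq> b"
  using arcs(1) starts(1) finishes(1) by (metis arc_distinct_ends)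

lemma ends_in: "a \<in> C1" "b \<in> C1" "a \<in> C2" "b \<in> C2" "a \<in> C3" "b \<in> C3"
  using meets by auto

lemma compact_arcs: "compact C1" "compact C2" "compact C3"
  using arcs by (simp_all add: compact_arc_image)

lemma not_just_ends: "C1 - {a, b} \<noteq> {}"
proof
  assume "C1 - {a, b} = {}"
  then have "finite C1"
    by (meson Diff_eq_empty_iff finite.emptyI finite.insertI finite_subset)
  moreover have "connected C1"
    using arcs(1) by (simp add: arc_imp_path connected_path_image)
  ultimately show False
    using ends_distinct ends_in(1,2) by (metis connected_finite_iff_sing empty_iff singletonD)
qed

lemma cycle:
  "inside (C1 \<union> C2) \<noteq> {}" "connected (inside (C1 \<union> C2))"
  "frontier (inside (C1 \<union> C2)) = C1 \<union> C2"
proof -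
  let ?g = "c1 +++ reversepath c2"
  have "simple_path ?g"
    using arcs starts finishes meets(1)
    by (intro simple_path_join_loop) (auto simp: arc_reversepath)
  moreover have "pathfinish ?g = pathstart ?g" "path_image ?g = C1 \<union> C2"
    using starts finishes by (auto simp: path_image_join)
  ultimately show "inside (C1 \<union> C2) \<noteq> {}" "connected (inside (C1 \<union> C2))"
    "frontier (inside (C1 \<union> C2)) = C1 \<union> C2"
    using Jordan_inside_outside[of ?g] by auto
qed

text \<open>
  When the third arc runs inside the closed curve formed by the other two, it cuts that inside into
  two parts. This gives the three faces of the theta curve, and the arc that each of them stays
  away from can be read off.
\<close>

lemma face_closure_misses_arc_if_inside:
  assumes chord: "C3 \<inter> inside (C1 \<union> C2) \<noteq> {}"
    and K: "connected K" "K \<inter> (C1 \<union> C2 \<union> C3) = {}" "z \<in> K"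
  shows "\<exists>C\<in>{C1, C2, C3}. (C - {a, b}) \<inter> closure K = {}"
proof -
  have simple: "simple_path c1" "simple_path c2" "simple_path c3"
    using arcs by (simp_all add: arc_imp_simple_path)
  have split: "inside (C1 \<union> C3) \<union> inside (C2 \<union> C3) \<union> (C3 - {a, b}) = inside (C1 \<union> C2)"
    by (rule split_inside_simple_closed_curve
        [OF simple(1) starts(1) finishes(1) simple(2) starts(2) finishes(2)
          simple(3) starts(3) finishes(3) ends_distinct meets chord])
  have closed: "closed (C1 \<union> C2)" "closed (C1 \<union> C3)" "closed (C2 \<union> C3)"
    using compact_arcs by (auto intro: compact_imp_closed)
  have dis: "C1 \<inter> inside (C1 \<union> C2) = {}" "C2 \<inter> inside (C1 \<union> C2) = {}"
    using inside_no_overlap[of "C1 \<union> C2"] by blast+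
  consider "z \<in> inside (C1 \<union> C3)" | "z \<in> inside (C2 \<union> C3)" | "z \<in> outside (C1 \<union> C2)"
    using K inside_Un_outside[of "C1 \<union> C2"] split by blast
  then show ?thesis
  proof cases
    case 1
    then have "closure K \<subseteq> (C1 \<union> C3) \<union> inside (C1 \<union> C3)"
      using K closed by (intro component_closure_subset_inside) auto
    then have "(C2 - {a, b}) \<inter> closure K = {}"
      using split dis meets by blast
    then show ?thesis by blast
  next
    case 2
    then have "closure K \<subseteq> (C2 \<union> C3) \<union> inside (C2 \<union> C3)"
      using K closed by (intro component_closure_subset_inside) auto
    then have "(C1 - {a, b}) \<inter> closure K = {}"
      using split dis meets by blast
    then show ?thesis by blast
  next
    case 3
    then have "closure K \<subseteq> (C1 \<union> C2) \<union> outside (C1 \<union> C2)"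
      using K closed by (intro component_closure_subset_outside) auto
    moreover have "C3 - {a, b} \<subseteq> inside (C1 \<union> C2)"
      using split by blast
    moreover have "inside (C1 \<union> C2) \<inter> ((C1 \<union> C2) \<union> outside (C1 \<union> C2)) = {}"
      using inside_no_overlap[of "C1 \<union> C2"] inside_Int_outside[of "C1 \<union> C2"] by blast
    ultimately have "(C3 - {a, b}) \<inter> closure K = {}"
      by blast
    then show ?thesis by blast
  qed
qed

text \<open>
  If the two insides met, each would be a connected set avoiding the boundary of the other, so they
  would coincide. But then their boundaries would coincide too, whereas the interior of the first
  arc lies on only one of them.
\<close>

lemma insides_disjoint:
  assumes "C1 \<inter> inside (C2 \<union> C3) = {}" "C3 \<inter> inside (C1 \<union> C2) = {}"
  shows "inside (C1 \<union> C2) \<inter> inside (C2 \<union> C3) = {}"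
proof (rule ccontr)
  assume "inside (C1 \<union> C2) \<inter> inside (C2 \<union> C3) \<noteq> {}"
  then obtain z where z: "z \<in> inside (C1 \<union> C2)" "z \<in> inside (C2 \<union> C3)" by blast
  interpret r: theta_curve c2 c3 c1 a b by (rule rotate)
  have "inside (C1 \<union> C2) \<subseteq> inside (C2 \<union> C3)"
  proof
    fix w assume "w \<in> inside (C1 \<union> C2)"
    moreover have "inside (C1 \<union> C2) \<subseteq> - (C2 \<union> C3)"
      using assms inside_no_overlap[of "C1 \<union> C2"] by blast
    ultimately have "connected_component (- (C2 \<union> C3)) z w"
      using cycle(2) z(1) unfolding connected_component_def by blast
    then show "w \<in> inside (C2 \<union> C3)"
      using z(2) by (rule inside_same_component)
  qed
  moreover have "inside (C2 \<union> C3) \<subseteq> inside (C1 \<union> C2)"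
  proof
    fix w assume "w \<in> inside (C2 \<union> C3)"
    moreover have "inside (C2 \<union> C3) \<subseteq> - (C1 \<union> C2)"
      using assms inside_no_overlap[of "C2 \<union> C3"] by blast
    ultimately have "connected_component (- (C1 \<union> C2)) z w"
      using r.cycle(2) z(2) unfolding connected_component_def by blast
    then show "w \<in> inside (C1 \<union> C2)"
      using z(1) by (rule inside_same_component)
  qed
  ultimately have "C1 \<union> C2 = C2 \<union> C3"
    using cycle(3) r.cycle(3) by (metis subset_antisym)
  then show False
    using not_just_ends meets by blast
qed

text \<open>
  This reduces an arbitrary theta curve to the case treated above. If every arc ran outside the
  curve formed by the other two, a point \<open>z\<close> inside the curve of the second and third arc would be
  outside the two curves that use the first arc, and so would a point \<open>w\<close> far away. The curve of arcs
  one and two and the curve of arcs one and three meet in a connected set, so by Janiszewski's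
  theorem their union, which is the whole theta curve, does not separate \<open>z\<close> from \<open>w\<close>, although one of
  them is inside and the other is outside the curve of arcs two and three.
\<close>

lemma some_arc_inside:
  "C1 \<inter> inside (C2 \<union> C3) \<noteq> {} \<or> C2 \<inter> inside (C1 \<union> C3) \<noteq> {} \<or> C3 \<inter> inside (C1 \<union> C2) \<noteq> {}"
proof (rule ccontr)
  assume "\<not> ?thesis"
  then have out: "C1 \<inter> inside (C2 \<union> C3) = {}" "C2 \<inter> inside (C1 \<union> C3) = {}"
    "C3 \<inter> inside (C1 \<union> C2) = {}" by auto
  interpret r: theta_curve c2 c3 c1 a b by (rule rotate)
  interpret s: theta_curve c1 c3 c2 a b by (rule swap)
  have comp: "compact (C1 \<union> C2)" "compact (C1 \<union> C3)" "compact (C2 \<union> C3)"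
    using compact_arcs by auto
  obtain z where z: "z \<in> inside (C2 \<union> C3)"
    using r.cycle(1) by blast
  have "inside (C1 \<union> C2) \<inter> inside (C2 \<union> C3) = {}"
    using out by (intro insides_disjoint)
  moreover have "inside (C1 \<union> C3) \<inter> inside (C3 \<union> C2) = {}"
    using out by (intro s.insides_disjoint) (simp_all add: Un_commute)
  moreover have "z \<notin> C2" "z \<notin> C3" "z \<notin> C1"
    using z out inside_no_overlap[of "C2 \<union> C3"] by blast+
  moreover have "x \<in> outside S \<longleftrightarrow> x \<notin> S \<and> x \<notin> inside S" for x :: complex and S
    using inside_Un_outside[of S] inside_Int_outside[of S] by blast
  ultimately have zout: "z \<in> outside (C1 \<union> C2)" "z \<in> outside (C1 \<union> C3)"
    using z by (auto simp: Un_commute)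
  have "bounded (C1 \<union> C2 \<union> C3)"
    using compact_arcs by (simp add: compact_imp_bounded)
  then obtain w where w: "w \<in> outside (C1 \<union> C2 \<union> C3)"
    using outside_bounded_nonempty by blast
  have wout: "w \<in> outside (C1 \<union> C2)" "w \<in> outside (C1 \<union> C3)" "w \<in> outside (C2 \<union> C3)"
    using w outside_mono[of _ "C1 \<union> C2 \<union> C3"] by blast+
  have conn: "connected_component (- S) z w"
    if "compact S" "z \<in> outside S" "w \<in> outside S" for S :: "complex set"
  proof -
    have "connected (outside S)"
      using that(1) by (intro connected_outside) (auto simp: compact_imp_bounded)
    then show ?thesis
      using that unfolding connected_component_def
      by (metis outside_no_overlap disjoint_eq_subset_Compl)
  qed
  have "(C1 \<union> C2) \<inter> (C1 \<union> C3) = C1"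
    using meets by blast
  then have "connected ((C1 \<union> C2) \<inter> (C1 \<union> C3))"
    using arcs(1) by (simp add: arc_imp_path connected_path_image)
  then have "connected_component (- ((C1 \<union> C2) \<union> (C1 \<union> C3))) z w"
    using comp zout wout by (intro Janiszewski conn) (auto intro: compact_imp_closed)
  then have "connected_component (- (C2 \<union> C3)) z w"
    by (rule connected_component_of_subset) auto
  then have "w \<in> inside (C2 \<union> C3)"
    using z by (rule inside_same_component)
  then show False
    using wout(3) inside_Int_outside by blast
qed

theorem face_closure_misses_arc:
  assumes "connected K" "K \<inter> (C1 \<union> C2 \<union> C3) = {}" "z \<in> K"
  shows "\<exists>C\<in>{C1, C2, C3}. (C - {a, b}) \<inter> closure K = {}"
proof -
  interpret r: theta_curve c2 c3 c1 a b by (rule rotate)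
  interpret q: theta_curve c3 c1 c2 a b by (rule r.rotate)
  consider "C3 \<inter> inside (C1 \<union> C2) \<noteq> {}" | "C1 \<inter> inside (C2 \<union> C3) \<noteq> {}"
    | "C2 \<inter> inside (C3 \<union> C1) \<noteq> {}"
    using some_arc_inside by (auto simp: Un_commute)
  then show ?thesis
  proof cases
    case 1
    then show ?thesis using assms by (rule face_closure_misses_arc_if_inside)
  next
    case 2
    moreover have "K \<inter> (C2 \<union> C3 \<union> C1) = {}"
      using assms(2) by blast
    ultimately show ?thesis
      using r.face_closure_misses_arc_if_inside[OF _ assms(1) _ assms(3)] by blast
  next
    case 3
    moreover have "K \<inter> (C3 \<union> C1 \<union> C2) = {}"
      using assms(2) by blast
    ultimately show ?thesis
      using q.face_closure_misses_arc_if_inside[OF _ assms(1) _ assms(3)] by blast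
  qed
qed

end

section \<open>The complete bipartite graph on three and three vertices\<close>

text \<open>
  The family \<open>g\<close> orients every edge from its end in \<open>A\<close> to its end in \<open>B\<close>, so that two edges at the same
  vertex of \<open>B\<close> can be joined to an arc of a theta curve.
\<close>

lemma no_K33_in_plane:
  fixes g :: "'u \<Rightarrow> 'v \<Rightarrow> real \<Rightarrow> complex"
  assumes card: "card A = 3" "card B = 3"
    and inj: "inj_on p A" "inj_on q B"
    and arc: "\<And>u v. u \<in> A \<Longrightarrow> v \<in> B \<Longrightarrow> arc (g u v)"
    and start: "\<And>u v. u \<in> A \<Longrightarrow> v \<in> B \<Longrightarrow> pathstart (g u v) = p u"
    and finish: "\<And>u v. u \<in> A \<Longrightarrow> v \<in> B \<Longrightarrow> pathfinish (g u v) = q v"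
    and meet: "\<And>u v u' v'. \<lbrakk>u \<in> A; v \<in> B; u' \<in> A; v' \<in> B; (u, v) \<noteq> (u', v')\<rbrakk> \<Longrightarrow>
       path_image (g u v) \<inter> path_image (g u' v') \<subseteq> {p u, q v} \<inter> {p u', q v'}"
  shows False
proof -
  obtain u1 u2 w where A: "A = {u1, u2, w}" "u1 \<noteq> u2" "u1 \<noteq> w" "u2 \<noteq> w"
    using card(1) by (metis card_3_iff)
  obtain v1 v2 v3 where B: "B = {v1, v2, v3}" "v1 \<noteq> v2" "v1 \<noteq> v3" "v2 \<noteq> v3"
    using card(2) by (metis card_3_iff)
  have p: "p u1 \<noteq> p u2" "p u1 \<noteq> p w" "p u2 \<noteq> p w"
    using inj(1) A by (auto simp: inj_on_def)
  have pq: "p u \<noteq> q v" if "u \<in> A" "v \<in> B" for u v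
    using arc_distinct_ends[OF arc[OF that]] start[OF that] finish[OF that] by simp
  have ends: "p u \<in> path_image (g u v)" "q v \<in> path_image (g u v)" if "u \<in> A" "v \<in> B" for u v
    using start[OF that] finish[OF that] by (metis pathstart_in_path_image pathfinish_in_path_image)+
  define P where "P v = g u1 v +++ reversepath (g u2 v)" for v
  have join: "pathfinish (g u1 v) = pathstart (reversepath (g u2 v))" if "v \<in> B" for v
    using that A finish by simp
  have imP: "path_image (P v) = path_image (g u1 v) \<union> path_image (g u2 v)" if "v \<in> B" for v
    using join[OF that] by (simp add: P_def path_image_join)
  have arcP: "arc (P v)" if "v \<in> B" for v
  proof -
    have "path_image (g u1 v) \<inter> path_image (g u2 v) \<subseteq> {q v}"
      using meet[of u1 v u2 v] A that p pq by auto
    then show ?thesis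
      unfolding P_def using that A arc finish
      by (intro arc_join) (auto simp: arc_reversepath)
  qed
  have stP: "pathstart (P v) = p u1" "pathfinish (P v) = p u2" if "v \<in> B" for v
    using that A start by (auto simp: P_def)
  have meetP: "path_image (P v) \<inter> path_image (P v') = {p u1, p u2}"
    if v: "v \<in> B" "v' \<in> B" "v \<noteq> v'" for v v'
  proof
    have "q v \<noteq> q v'"
      using inj(2) v by (auto simp: inj_on_def)
    moreover have "path_image (g i v) \<inter> path_image (g j v') \<subseteq> {p i, q v} \<inter> {p j, q v'}"
      if "i \<in> {u1, u2}" "j \<in> {u1, u2}" for i j
      using that v A by (intro meet) auto
    ultimately show "path_image (P v) \<inter> path_image (P v') \<subseteq> {p u1, p u2}"
      unfolding imP[OF v(1)] imP[OF v(2)] using pq v A by fast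
    show "{p u1, p u2} \<subseteq> path_image (P v) \<inter> path_image (P v')"
      unfolding imP[OF v(1)] imP[OF v(2)] using ends v A by auto
  qed
  interpret theta_curve "P v1" "P v2" "P v3" "p u1" "p u2"
    using arcP stP meetP B by unfold_locales auto
  \<comment> \<open>The three edges at \<open>w\<close> without their far ends: a connected set off the theta curve whose closure
    contains all three of those ends.\<close>
  define K where "K = (\<Union>v\<in>B. g w v ` {0..<1})"
  have pw: "p w \<in> g w v ` {0..<1}" if "v \<in> B" for v
    using start[OF _ that, of w] A by (auto simp: pathstart_def intro!: image_eqI[of _ _ 0])
  have cont: "continuous_on {0..1} (g w v)" if "v \<in> B" for v
    using arc[OF _ that, of w] A by (auto dest!: arc_imp_path simp: path_def)
  have connK: "connected K"
    unfolding K_def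
  proof (rule connected_Union)
    fix S assume "S \<in> (\<lambda>v. g w v ` {0..<1}) ` B"
    then show "connected S"
      using cont by (auto intro!: connected_continuous_image intro: continuous_on_subset[of "{0..1}"])
  next
    show "\<Inter> ((\<lambda>v. g w v ` {0..<1}) ` B) \<noteq> {}"
      using pw by blast
  qed
  have dis: "g w v t \<notin> path_image (g u v')"
    if v: "v \<in> B" "v' \<in> B" and u: "u \<in> {u1, u2}" and t: "t \<in> {0..<1}" for v v' u t
  proof
    assume "g w v t \<in> path_image (g u v')"
    moreover have "g w v t \<in> path_image (g w v)"
      using t by (auto simp: path_image_def)
    moreover have "path_image (g w v) \<inter> path_image (g u v') \<subseteq> {p w, q v} \<inter> {p u, q v'}"
      using v u A by (intro meet) auto
    ultimately have "g w v t \<in> {p w, q v} \<inter> {p u, q v'}"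
      by blast
    moreover have "p w \<noteq> p u" "p w \<noteq> q v'"
      using p u pq[of w v'] v A by auto
    ultimately have "g w v t = q v"
      by auto
    then have "g w v t = g w v 1"
      using finish[of w v] v A by (simp add: pathfinish_def)
    then have "t = 1"
      using arc[of w v] v A t by (auto simp: arc_def inj_on_def)
    then show False
      using t by simp
  qed
  have disK: "K \<inter> (C1 \<union> C2 \<union> C3) = {}"
    unfolding K_def using dis B imP by auto
  have "p w \<in> K"
    using pw B by (auto simp: K_def)
  with connK disK have "\<exists>C\<in>{C1, C2, C3}. (C - {p u1, p u2}) \<inter> closure K = {}"
    by (rule face_closure_misses_arc)
  then obtain C where C: "C \<in> {C1, C2, C3}" "(C - {p u1, p u2}) \<inter> closure K = {}"
    by (rule bexE)
  then obtain v where v: "v \<in> B" "C = path_image (P v)"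
    using B by blast
  have "g w v ` closure {0..<1} \<subseteq> closure K"
    using cont[OF v(1)] v(1)
    by (intro image_closure_subset) (auto simp: K_def intro: closure_subset[THEN subsetD])
  then have "g w v 1 \<in> closure K"
    by (simp add: image_subset_iff)
  then have "q v \<in> closure K"
    using finish[of w v] v A by (simp add: pathfinish_def)
  moreover have "q v \<in> C"
    using v A ends[of u1 v] imP by auto
  ultimately show False
    using C(2) pq[of _ v] v A by force
qed

lemma not_planar_if_K33:
  assumes sub: "A \<subseteq> pverts G" "B \<subseteq> pverts G" "A \<times> B \<subseteq> parcs G"
    and card: "card A = 3" "card B = 3" and disjoint: "A \<inter> B = {}"
  shows "\<not> planar G"
proof
  assume "planar G"
  then obtain p c where drawing: "planar_drawing G p c"
    by (auto simp: planar_def)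
  have inj: "inj_on p (pverts G)"
    using drawing by (auto simp: planar_drawing_def)
  have edge: "arc (c {u, v})" "{pathstart (c {u, v}), pathfinish (c {u, v})} = {p u, p v}"
    "path_image (c {u, v}) \<inter> p ` pverts G = {p u, p v}" if "(u, v) \<in> parcs G" for u v
    using drawing that unfolding planar_drawing_def by blast+
  have cross: "path_image (c {u, v}) \<inter> path_image (c {x, y}) \<subseteq> p ` pverts G"
    if uv: "(u, v) \<in> parcs G" and xy: "(x, y) \<in> parcs G" and ne: "{u, v} \<noteq> {x, y}" for u v x y
  proof -
    have "\<forall>(u, v) \<in> parcs G. \<forall>(x, y) \<in> parcs G. {u, v} \<noteq> {x, y} \<longrightarrow>
        path_image (c {u, v}) \<inter> path_image (c {x, y}) \<subseteq> p ` pverts G"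
      using drawing unfolding planar_drawing_def by (elim conjE)
    from bspec[OF this uv] have "\<forall>(x, y) \<in> parcs G. {u, v} \<noteq> {x, y} \<longrightarrow>
        path_image (c {u, v}) \<inter> path_image (c {x, y}) \<subseteq> p ` pverts G"
      by simp
    from bspec[OF this xy] ne show ?thesis
      by simp
  qed
  \<comment> \<open>A drawing leaves the direction of each arc open; \<open>g u v\<close> starts at \<open>p u\<close>.\<close>
  define g where "g u v = (if pathstart (c {u, v}) = p u then c {u, v} else reversepath (c {u, v}))"
    for u v
  have im: "path_image (g u v) = path_image (c {u, v})" for u v
    by (simp add: g_def)
  show False
  proof (rule no_K33_in_plane[OF card, of p p g])
    show "inj_on p A" "inj_on p B"
      using inj sub by (auto intro: inj_on_subset)
    fix u v assume uv: "u \<in> A" "v \<in> B"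
    then have e: "(u, v) \<in> parcs G"
      using sub by blast
    show "arc (g u v)"
      using edge(1)[OF e] by (simp add: g_def arc_reversepath)
    show "pathstart (g u v) = p u" "pathfinish (g u v) = p v"
      using edge(2)[OF e] by (auto simp: g_def doubleton_eq_iff)
  next
    fix u v u' v' assume uv: "u \<in> A" "v \<in> B" "u' \<in> A" "v' \<in> B" "(u, v) \<noteq> (u', v')"
    then have e: "(u, v) \<in> parcs G" "(u', v') \<in> parcs G"
      using sub by blast+
    have "{u, v} \<noteq> {u', v'}"
      using uv disjoint by (auto simp: doubleton_eq_iff)
    then show "path_image (g u v) \<inter> path_image (g u' v') \<subseteq> {p u, p v} \<inter> {p u', p v'}"
      unfolding im using cross[OF e] edge(3)[OF e(1)] edge(3)[OF e(2)] by blast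
  qed
qed

section \<open>A straight-line drawing of four vertices\<close>

text \<open>
  The centroid of the triangle with corners \<open>1\<close>, \<open>\<i>\<close> and \<open>-1 - \<i>\<close> is the origin.
\<close>

definition K4_points :: "complex set" where
  "K4_points = {0, 1, \<i>, - 1 - \<i>}"

lemma K4_pointsI:
  "Re z = 0 \<Longrightarrow> Im z = 0 \<Longrightarrow> z \<in> K4_points"
  "Re z = 1 \<Longrightarrow> Im z = 0 \<Longrightarrow> z \<in> K4_points"
  "Re z = 0 \<Longrightarrow> Im z = 1 \<Longrightarrow> z \<in> K4_points"
  "Re z = - 1 \<Longrightarrow> Im z = - 1 \<Longrightarrow> z \<in> K4_points"
  by (simp_all add: K4_points_def complex_eq_iff)

text \<open>
  With the six segments given by linear constraints on coordinates, questions about their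
  intersections become linear arithmetic.
\<close>

lemma K4_segments:
  "z \<in> closed_segment 0 1 \<longleftrightarrow> Im z = 0 \<and> 0 \<le> Re z \<and> Re z \<le> 1"
  "z \<in> closed_segment 0 \<i> \<longleftrightarrow> Re z = 0 \<and> 0 \<le> Im z \<and> Im z \<le> 1"
  "z \<in> closed_segment 0 (- 1 - \<i>) \<longleftrightarrow> Re z = Im z \<and> - 1 \<le> Re z \<and> Re z \<le> 0"
  "z \<in> closed_segment 1 \<i> \<longleftrightarrow> Re z + Im z = 1 \<and> 0 \<le> Re z \<and> Re z \<le> 1"
  "z \<in> closed_segment 1 (- 1 - \<i>) \<longleftrightarrow> Re z - 2 * Im z = 1 \<and> - 1 \<le> Im z \<and> Im z \<le> 0"
  "z \<in> closed_segment \<i> (- 1 - \<i>) \<longleftrightarrow> Im z - 2 * Re z = 1 \<and> - 1 \<le> Re z \<and> Re z \<le> 0"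
proof -
  show "z \<in> closed_segment 0 1 \<longleftrightarrow> Im z = 0 \<and> 0 \<le> Re z \<and> Re z \<le> 1"
    by (auto simp: closed_segment_def complex_eq_iff intro!: exI[of _ "Re z"])
  show "z \<in> closed_segment 0 \<i> \<longleftrightarrow> Re z = 0 \<and> 0 \<le> Im z \<and> Im z \<le> 1"
    by (auto simp: closed_segment_def complex_eq_iff intro!: exI[of _ "Im z"])
  show "z \<in> closed_segment 0 (- 1 - \<i>) \<longleftrightarrow> Re z = Im z \<and> - 1 \<le> Re z \<and> Re z \<le> 0"
    by (auto simp: closed_segment_def complex_eq_iff intro!: exI[of _ "- Re z"])
  show "z \<in> closed_segment 1 \<i> \<longleftrightarrow> Re z + Im z = 1 \<and> 0 \<le> Re z \<and> Re z \<le> 1"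
    by (auto simp: closed_segment_def complex_eq_iff intro!: exI[of _ "Im z"])
  show "z \<in> closed_segment 1 (- 1 - \<i>) \<longleftrightarrow> Re z - 2 * Im z = 1 \<and> - 1 \<le> Im z \<and> Im z \<le> 0"
    by (auto simp: closed_segment_def complex_eq_iff intro!: exI[of _ "- Im z"])
  show "z \<in> closed_segment \<i> (- 1 - \<i>) \<longleftrightarrow> Im z - 2 * Re z = 1 \<and> - 1 \<le> Re z \<and> Re z \<le> 0"
    by (auto simp: closed_segment_def complex_eq_iff intro!: exI[of _ "- Re z"])
qed

text \<open>
  One orientation is listed for each of the six segments, matching the characterisations above.
\<close>

definition K4_edges :: "(complex \<times> complex) set" where
  "K4_edges = {(0, 1), (0, \<i>), (0, - 1 - \<i>), (1, \<i>), (1, - 1 - \<i>), (\<i>, - 1 - \<i>)}"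

lemma K4_edge_cases:
  assumes "a \<in> K4_points" "b \<in> K4_points" "a \<noteq> b"
  obtains a' b' where "(a', b') \<in> K4_edges" "{a', b'} = {a, b}"
    "closed_segment a' b' = closed_segment a b"
proof -
  have "(a, b) \<in> K4_edges \<or> (b, a) \<in> K4_edges"
    using assms unfolding K4_points_def K4_edges_def by auto
  then show ?thesis
    using that[of a b] that[of b a] by (auto simp: insert_commute closed_segment_commute)
qed

lemma K4_segment_vertices:
  assumes "a \<in> K4_points" "b \<in> K4_points" "a \<noteq> b"
  shows "closed_segment a b \<inter> K4_points = {a, b}"
proof -
  obtain a' b' where ab: "(a', b') \<in> K4_edges" "{a', b'} = {a, b}"
    "closed_segment a' b' = closed_segment a b"
    using K4_edge_cases[OF assms] .
  have "closed_segment a' b' \<inter> K4_points \<subseteq> {a', b'}"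
    using ab(1) by (auto simp: K4_edges_def K4_points_def K4_segments)
  then show ?thesis
    using assms ab(2,3) by auto
qed

lemma K4_segments_cross:
  assumes "a \<in> K4_points" "b \<in> K4_points" "a \<noteq> b"
    and "c \<in> K4_points" "d \<in> K4_points" "c \<noteq> d" and "{a, b} \<noteq> {c, d}"
  shows "closed_segment a b \<inter> closed_segment c d \<subseteq> K4_points"
proof -
  obtain a' b' where ab: "(a', b') \<in> K4_edges" "{a', b'} = {a, b}"
    "closed_segment a' b' = closed_segment a b"
    using K4_edge_cases[OF assms(1-3)] .
  obtain c' d' where cd: "(c', d') \<in> K4_edges" "{c', d'} = {c, d}"
    "closed_segment c' d' = closed_segment c d"
    using K4_edge_cases[OF assms(4-6)] .
  have "(a', b') \<noteq> (c', d')"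
    using ab(2) cd(2) assms(7) by auto
  have "closed_segment a' b' \<inter> closed_segment c' d' \<subseteq> K4_points"
  proof
    fix z assume "z \<in> closed_segment a' b' \<inter> closed_segment c' d'"
    then have z: "z \<in> closed_segment a' b'" "z \<in> closed_segment c' d'" by simp_all
    show "z \<in> K4_points"
      using ab(1) cd(1) z \<open>(a', b') \<noteq> (c', d')\<close>
      unfolding K4_edges_def insert_iff prod.inject empty_iff
      apply (elim disjE FalseE conjE)
      apply (simp_all only: K4_segments simp_thms)
      by ((rule K4_pointsI(1); linarith) | (rule K4_pointsI(2); linarith) |
           (rule K4_pointsI(3); linarith) | (rule K4_pointsI(4); linarith))+
  qed
  then show ?thesis
    by (simp only: ab(3) cd(3))
qed

lemma planar_if_card_le_4:
  assumes finite: "finite (pverts G)" and card: "card (pverts G) \<le> 4"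
    and arcs: "parcs G \<subseteq> pverts G \<times> pverts G" and loopfree: "\<And>v. (v, v) \<notin> parcs G"
  shows "planar G"
proof -
  have "card K4_points = 4"
    by (simp add: K4_points_def complex_eq_iff)
  moreover have "finite K4_points"
    by (simp add: K4_points_def)
  ultimately obtain p where p: "p ` pverts G \<subseteq> K4_points" "inj_on p (pverts G)"
    using card_le_inj[OF finite, of K4_points] card by auto
  \<comment> \<open>The arc of an edge is indexed by its unordered set of ends, so a direction has to be chosen.\<close>
  define e where "e S = (SOME (a, b). {a, b} = p ` S)" for S
  define c where "c S = linepath (fst (e S)) (snd (e S))" for S
  have e: "{fst (e {u, v}), snd (e {u, v})} = {p u, p v}" for u v
  proof -
    have "case e {u, v} of (a, b) \<Rightarrow> {a, b} = p ` {u, v}"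
      unfolding e_def by (rule someI[of _ "(p u, p v)"]) simp
    then show ?thesis by (auto simp: case_prod_beta)
  qed
  have im: "path_image (c {u, v}) = closed_segment (p u) (p v)" for u v
    using e[of u v] by (auto simp: c_def doubleton_eq_iff closed_segment_commute)
  have edge: "p u \<in> K4_points" "p v \<in> K4_points" "p u \<noteq> p v" "u \<in> pverts G" "v \<in> pverts G"
    if uv: "(u, v) \<in> parcs G" for u v
  proof -
    show "u \<in> pverts G" "v \<in> pverts G"
      using uv arcs by auto
    then show "p u \<in> K4_points" "p v \<in> K4_points"
      using p(1) by auto
    have "u \<noteq> v"
      using uv loopfree by auto
    then show "p u \<noteq> p v"
      using \<open>u \<in> pverts G\<close> \<open>v \<in> pverts G\<close> p(2) by (simp add: inj_on_eq_iff)
  qed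
  have "arc (c {u, v}) \<and> {pathstart (c {u, v}), pathfinish (c {u, v})} = {p u, p v} \<and>
      path_image (c {u, v}) \<inter> p ` pverts G = {p u, p v}" if uv: "(u, v) \<in> parcs G" for u v
  proof (intro conjI)
    show "arc (c {u, v})"
      using e[of u v] edge(3)[OF uv] by (auto simp: c_def doubleton_eq_iff)
    show "{pathstart (c {u, v}), pathfinish (c {u, v})} = {p u, p v}"
      using e[of u v] by (simp add: c_def)
    show "path_image (c {u, v}) \<inter> p ` pverts G = {p u, p v}"
      unfolding im using K4_segment_vertices[OF edge(1-3)[OF uv]] edge(4,5)[OF uv] p(1) by blast
  qed
  moreover have "path_image (c {u, v}) \<inter> path_image (c {x, y}) \<subseteq> p ` pverts G"
    if uv: "(u, v) \<in> parcs G" and xy: "(x, y) \<in> parcs G" and ne: "{u, v} \<noteq> {x, y}" for u v x y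
  proof -
    have "{p u, p v} \<noteq> {p x, p y}"
      using ne edge(4,5)[OF uv] edge(4,5)[OF xy] p(2) by (auto simp: doubleton_eq_iff inj_on_eq_iff)
    then have "closed_segment (p u) (p v) \<inter> closed_segment (p x) (p y) \<subseteq> K4_points"
      using edge(1-3)[OF uv] edge(1-3)[OF xy] by (intro K4_segments_cross)
    then show ?thesis
      unfolding im using K4_segment_vertices[OF edge(1-3)[OF uv]] edge(4,5)[OF uv] by blast
  qed
  ultimately have "planar_drawing G p c"
    using p(2) unfolding planar_drawing_def by blast
  then show ?thesis
    by (auto simp: planar_def)
qed

section \<open>The units of a finite commutative ring\<close>

text \<open>
  In the ring \<open>F\<^sub>2[x]/(x\<^sup>5 - 1)\<close>, which is isomorphic to \<open>F\<^sub>2 \<times> F\<^sub>1\<^sub>6\<close>, the element \<open>1 + x + x\<^sup>4\<close> is a unit of order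
  three, hence not a power of \<open>x\<close>. A ring of characteristic two with an element \<open>x\<close> satisfying
  \<open>x\<^sup>5 = 1\<close> contains an image of this unit, and in a group of order five that image is trivial.
\<close>

lemma (in cring) card_Units_neq_5:
  assumes fin: "finite (Units R)"
  shows "card (Units R) \<noteq> 5"
proof
  assume card: "card (Units R) = 5"
  have five: "z \<otimes> (z \<otimes> (z \<otimes> (z \<otimes> z))) = \<one>" if "z \<in> Units R" for z
    using units_power_order_eq_one[OF fin that] that
    by (simp add: card numeral_eq_Suc m_ac Units_closed)
  have "\<ominus> \<one> \<in> Units R"
    by (metis Units_one_closed Units_minus_one_closed)
  from five[OF this] have minus_one: "\<ominus> \<one> = \<one>"
    by (simp add: l_minus)
  \<comment> \<open>Characteristic two. The second form of this rule, like the second form of \<open>x\<^sup>5 = 1\<close> below, lets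
    rewriting cancel inside right-nested sums and products.\<close>
  have double: "z \<oplus> z = \<zero>" if "z \<in> carrier R" for z
    using that by (metis l_minus l_one minus_one one_closed r_neg)
  have double': "z \<oplus> (z \<oplus> y) = y" if "z \<in> carrier R" "y \<in> carrier R" for z y
    using that double by (simp add: a_assoc[symmetric])
  obtain x where x: "x \<in> Units R" "x \<noteq> \<one>"
  proof (rule ccontr)
    assume "\<not> thesis"
    then have "Units R \<subseteq> {\<one>}" using that by blast
    then have "card (Units R) \<le> 1"
      using card_mono[of "{\<one>}"] by simp
    then show False using card by simp
  qed
  have xc: "x \<in> carrier R" using x by blast
  note x5 = five[OF x(1)]
  have x5': "x \<otimes> (x \<otimes> (x \<otimes> (x \<otimes> (x \<otimes> y)))) = y" if "y \<in> carrier R" for y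
  proof -
    have "x \<otimes> (x \<otimes> (x \<otimes> (x \<otimes> (x \<otimes> y)))) = (x \<otimes> (x \<otimes> (x \<otimes> (x \<otimes> x)))) \<otimes> y"
      using xc that by (simp add: m_assoc)
    then show ?thesis using x5 that by simp
  qed
  define y where "y = x \<otimes> (x \<otimes> (x \<otimes> x))"
  have yc: "y \<in> carrier R" using xc by (simp add: y_def)
  have xy: "x \<otimes> y = \<one>" using x5 by (simp add: y_def)
  define u where "u = \<one> \<oplus> (x \<oplus> y)"
  have uc: "u \<in> carrier R" using xc yc by (simp add: u_def)
  have u3: "u \<otimes> (u \<otimes> u) = \<one>"
    using xc unfolding u_def y_def
    by (simp add: l_distr r_distr a_ac m_ac x5 x5' double double')
  then have "u \<in> Units R"
    using uc m_comm unfolding Units_def by (auto intro!: bexI[of _ "u \<otimes> u"])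
  from five[OF this] have "u \<otimes> u = \<one>"
    using u3 uc by simp
  then have "u = \<one>"
    using u3 uc by simp
  then have "x \<oplus> y = \<zero>"
    using double'[of \<one> "x \<oplus> y"] double[of \<one>] xc yc by (simp add: u_def)
  then have "x = y"
    using double'[of y x] xc yc by (simp add: a_comm)
  then have "x \<otimes> x = \<one>"
    using xy by simp
  then have "x = \<one>"
    using x5 xc by simp
  then show False
    using x(2) by simp
qed

text \<open>
  If some unit \<open>x\<close> differs from its inverse, \<open>{1, x, x\<^sup>-\<^sup>1}\<close> is such a set; otherwise any three units are.
\<close>

lemma (in cring) inverse_closed_triple:
  assumes card: "3 \<le> card (Units R)"
  obtains A where "A \<subseteq> Units R" "card A = 3" "\<forall>r\<in>A. inv r \<in> A"
proof (cases "\<exists>x\<in>Units R. inv x \<noteq> x")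
  case True
  then obtain x where x: "x \<in> Units R" "inv x \<noteq> x" by blast
  then have "x \<noteq> \<one>" "inv x \<noteq> \<one>"
    by (metis Units_inv_inv inv_one)+
  then show ?thesis
    using x by (intro that[of "{\<one>, x, inv x}"]) auto
next
  case False
  obtain A where "A \<subseteq> Units R" "card A = 3"
    using obtain_subset_with_card_n[OF card] by metis
  then show ?thesis
    using False by (intro that[of A]) auto
qed

text \<open>
  Six units leave at least three outside an inverse-closed triple, and these are the other side of
  the \<open>K\<^sub>3\<^sub>,\<^sub>3\<close>.
\<close>

lemma (in cring) not_planar_if_6_units:
  assumes fin: "finite (Units R)" and card: "6 \<le> card (Units R)"
  shows "\<not> planar (complement_unity_product_graph R)"
proof -
  have three: "3 \<le> card (Units R)"
    using card by simp
  obtain A where A: "A \<subseteq> Units R" "card A = 3" "\<forall>r\<in>A. inv r \<in> A"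
    using inverse_closed_triple[OF three] .
  have "3 \<le> card (Units R - A)"
    using A card fin by (simp add: card_Diff_subset finite_subset)
  then obtain B where B: "B \<subseteq> Units R - A" "card B = 3"
    using obtain_subset_with_card_n by metis
  have "r \<otimes> s \<noteq> \<one>" if "r \<in> A" "s \<in> B" for r s
  proof
    assume "r \<otimes> s = \<one>"
    moreover have "r \<in> carrier R" "s \<in> carrier R"
      using that A(1) B(1) by auto
    ultimately have "inv r = s"
      by (intro comm_inv_char)
    then show False
      using that A(3) B(1) by blast
  qed
  then show ?thesis
    using A B
    by (intro not_planar_if_K33[of A _ B]) (fastforce simp: complement_unity_product_graph_def)+
qed

theorem theorem6p2:
  fixes R :: "('a, 'm) ring_scheme"
  assumes "cring R" and "finite (carrier R)"
  shows "planar (complement_unity_product_graph R) \<longleftrightarrow> card (Units R) \<le> 4"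
proof -
  interpret cring R by fact
  have fin: "finite (Units R)"
    using assms(2) by (rule rev_finite_subset) auto
  show ?thesis
  proof
    assume "planar (complement_unity_product_graph R)"
    then have "\<not> 6 \<le> card (Units R)"
      using not_planar_if_6_units[OF fin] by blast
    then show "card (Units R) \<le> 4"
      using card_Units_neq_5[OF fin] by linarith
  next
    assume "card (Units R) \<le> 4"
    then show "planar (complement_unity_product_graph R)"
      using fin by (intro planar_if_card_le_4) (auto simp: complement_unity_product_graph_def)
  qed
qed

end
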